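(* A Toeplitz graph $T_n\langle t_1,t_2\rangle$ is claw-free if and only if $n\le t_1+t_2$ or $t_2=2t_1$.
   Context: For integers $1\le t_1<t_2<n$, the Toeplitz graph $T_n\langle t_1,t_2\rangle$ is the simple graph with vertex set $\{1,\ldots,n\}$ in which $v$ and $w$ are adjacent if and only if $|v-w|\in\{t_1,t_2\}$. A claw is an induced subgraph isomorphic to $K_{1,3}$; a graph is claw-free if it has no claw. *)

theory Defs
  imports "Graph_Theory.Graph_Theory"
begin

text \<open>
  As usual in Graph_Theory, a simple graph is a symmetric loop-free digraph: an edge between
  \<open>v\<close> and \<open>w\<close> is the pair of arcs \<open>(v, w)\<close> and \<open>(w, v)\<close>. The difference is taken in \<open>int\<close>,
  as subtraction on \<open>nat\<close> truncates.
\<close>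

definition toeplitz_graph :: "nat \<Rightarrow> nat \<Rightarrow> nat \<Rightarrow> nat pair_pre_digraph" where
  "toeplitz_graph n t1 t2 =
    \<lparr> pverts = {1..n},
      parcs = {(v, w). v \<in> {1..n} \<and> w \<in> {1..n} \<and> \<bar>int v - int w\<bar> \<in> {int t1, int t2}} \<rparr>"

lemma pair_graph_toeplitz_graph:
  assumes "0 < t1" "0 < t2"
  shows "pair_graph (toeplitz_graph n t1 t2)"
proof -
  have "parcs (toeplitz_graph n t1 t2) \<subseteq> {1..n} \<times> {1..n}"
    by (auto simp: toeplitz_graph_def)
  then have "finite (parcs (toeplitz_graph n t1 t2))"
    by (rule finite_subset) simp
  then show ?thesis
    using assms
    by unfold_locales
      (auto simp: toeplitz_graph_def symmetric_def abs_minus_commute intro!: symI)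
qed

text \<open>
  The predicate \<open>complete_bipartite_digraph 1 3\<close> holds of every graph isomorphic to $K_{1,3}$,
  whatever its vertices, so no separate isomorphism is needed.
\<close>

definition is_claw_of :: "('a, 'b) pre_digraph \<Rightarrow> ('a, 'b) pre_digraph \<Rightarrow> bool" where
  "is_claw_of H G \<longleftrightarrow> induced_subgraph H G \<and> complete_bipartite_digraph 1 3 H"

definition claw_free :: "('a, 'b) pre_digraph \<Rightarrow> bool" where
  "claw_free G \<longleftrightarrow> (\<nexists>H. is_claw_of H G)"

end

theory Submission
  imports Defs
begin

text \<open>
  The neighbours of a vertex \<open>v\<close> are those of \<open>v - t1\<close>, \<open>v - t2\<close>, \<open>v + t1\<close>, \<open>v + t2\<close> that lie in
  \<open>{1..n}\<close>, so a claw centred at \<open>v\<close> has two of its three leaves on the same side of \<open>v\<close>.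

  If \<open>n \<le> t1 + t2\<close>, a vertex that has \<open>v + t2\<close> as a neighbour has no neighbour below it, and
  symmetrically for \<open>v - t2\<close>; a vertex with neither has only \<open>v - t1\<close> and \<open>v + t1\<close> left. Hence
  every degree is at most two and there is no room for a claw.
  If \<open>t2 = 2 * t1\<close>, the two neighbours on one side of \<open>v\<close> differ by \<open>t2 - t1 = t1\<close>, so they are
  adjacent and cannot both be leaves.

  If \<open>n > t1 + t2\<close> and \<open>t2 \<noteq> 2 * t1\<close>, then \<open>1\<close>, \<open>1 + 2 * t1\<close> and \<open>1 + t1 + t2\<close> are vertices, all adjacent to \<open>1 + t1\<close>.
  Their differences are \<open>2 * t1\<close>, \<open>t2 - t1\<close> and \<open>t1 + t2\<close>, the last of which exceeds \<open>t2\<close>,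
  while the first two could lie in \<open>{t1, t2}\<close> only for \<open>t2 = 2 * t1\<close>. So these vertices are the
  leaves of a claw.
\<close>

text \<open>
  A claw is determined by its vertex set, as it is an induced subgraph; so it amounts to a centre
  with three pairwise non-adjacent neighbours. The centre differs from the leaves because there are
  no loops, and arcs back to the centre come from symmetry.
\<close>
lemma (in graph) claw_free_iff:
  "claw_free G \<longleftrightarrow>
    (\<nexists>c x y z. x \<noteq> y \<and> x \<noteq> z \<and> y \<noteq> z \<and> c \<rightarrow>\<^bsub>G\<^esub> x \<and> c \<rightarrow>\<^bsub>G\<^esub> y \<and> c \<rightarrow>\<^bsub>G\<^esub> z \<and>
      \<not> x \<rightarrow>\<^bsub>G\<^esub> y \<and> \<not> x \<rightarrow>\<^bsub>G\<^esub> z \<and> \<not> y \<rightarrow>\<^bsub>G\<^esub> z)"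
proof -
  have ends_induced: "arcs_ends H = {(u, v) \<in> arcs_ends G. u \<in> verts H \<and> v \<in> verts H}"
    if "induced_subgraph H G" for H
    using that by (auto simp: induced_subgraph_def subgraph_def compatible_def arcs_ends_conv)
  have "\<exists>c x y z. x \<noteq> y \<and> x \<noteq> z \<and> y \<noteq> z \<and> c \<rightarrow>\<^bsub>G\<^esub> x \<and> c \<rightarrow>\<^bsub>G\<^esub> y \<and> c \<rightarrow>\<^bsub>G\<^esub> z \<and>
      \<not> x \<rightarrow>\<^bsub>G\<^esub> y \<and> \<not> x \<rightarrow>\<^bsub>G\<^esub> z \<and> \<not> y \<rightarrow>\<^bsub>G\<^esub> z"
    if claw: "is_claw_of H G" for H
  proof -
    have induced: "induced_subgraph H G"
      using claw by (simp add: is_claw_of_def)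
    obtain U V where UV: "verts H = U \<union> V" "U \<inter> V = {}" "card U = 1" "card V = 3"
      "arcs_ends H = U \<times> V \<union> V \<times> U"
      using claw by (auto simp: is_claw_of_def complete_bipartite_digraph_def)
    obtain c where U: "U = {c}"
      using UV(3) by (auto simp: card_1_singleton_iff)
    obtain x y z where V: "V = {x, y, z}" "x \<noteq> y" "x \<noteq> z" "y \<noteq> z"
      using UV(4) by (auto simp: card_3_iff)
    have iff: "(u, v) \<in> arcs_ends G \<longleftrightarrow> (u, v) \<in> {c} \<times> {x, y, z} \<union> {x, y, z} \<times> {c}"
      if "u \<in> {c, x, y, z}" "v \<in> {c, x, y, z}" for u v
    proof -
      have "u \<in> verts H" "v \<in> verts H"
        using that by (auto simp: UV(1) U V(1))
      then have "(u, v) \<in> arcs_ends G \<longleftrightarrow> (u, v) \<in> arcs_ends H"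
        using ends_induced[OF induced] by simp
      then show ?thesis
        by (simp only: UV(5) U V(1))
    qed
    have "c \<noteq> x" "c \<noteq> y" "c \<noteq> z"
      using UV(2) U V(1) by auto
    then show ?thesis
      using V(2-4) iff[of c x] iff[of c y] iff[of c z] iff[of x y] iff[of x z] iff[of y z]
      by blast
  qed
  moreover have "is_claw_of (G \<restriction> {c, x, y, z}) G"
    if leaves: "x \<noteq> y" "x \<noteq> z" "y \<noteq> z"
      and adjacent: "c \<rightarrow>\<^bsub>G\<^esub> x" "c \<rightarrow>\<^bsub>G\<^esub> y" "c \<rightarrow>\<^bsub>G\<^esub> z"
      and independent: "\<not> x \<rightarrow>\<^bsub>G\<^esub> y" "\<not> x \<rightarrow>\<^bsub>G\<^esub> z" "\<not> y \<rightarrow>\<^bsub>G\<^esub> z" for c x y z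
  proof -
    let ?S = "{c, x, y, z}"
    have "?S \<subseteq> verts G"
      using adjacent by (auto dest: adj_in_verts)
    then have induced: "induced_subgraph (G \<restriction> ?S) G"
      by (rule induced_induce)
    have ends: "arcs_ends (G \<restriction> ?S) = {(u, v) \<in> arcs_ends G. u \<in> ?S \<and> v \<in> ?S}"
      using ends_induced[OF induced] by simp
    have no_loop: "\<not> u \<rightarrow>\<^bsub>G\<^esub> u" for u
      using adj_not_same by blast
    have distinct: "c \<notin> {x, y, z}"
      using adjacent no_loop by auto
    have "arcs_ends (G \<restriction> ?S) = {c} \<times> {x, y, z} \<union> {x, y, z} \<times> {c}"
      unfolding ends
      using adjacent adjacent[THEN graph_symmetric] independent no_loop graph_symmetric[of y x]
        graph_symmetric[of z x] graph_symmetric[of z y]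
      by blast
    moreover have "graph (G \<restriction> ?S)"
      using induced sym_arcs
      by (blast intro: digraph.graphI digraphI_induced induced_graph_imp_symmetric)
    moreover have "verts (G \<restriction> ?S) = {c} \<union> {x, y, z}" "{c} \<inter> {x, y, z} = {}"
      "card {c} = 1" "card {x, y, z} = 3"
      using leaves distinct by auto
    ultimately show ?thesis
      unfolding is_claw_of_def complete_bipartite_digraph_def using induced by blast
  qed
  ultimately show ?thesis
    unfolding claw_free_def by blast
qed

lemma toeplitz_adjacent_iff:
  "v \<rightarrow>\<^bsub>with_proj (toeplitz_graph n t1 t2)\<^esub> w \<longleftrightarrow>
    v \<in> {1..n} \<and> w \<in> {1..n} \<and> (w = v + t1 \<or> v = w + t1 \<or> w = v + t2 \<or> v = w + t2)"
  by (auto simp: toeplitz_graph_def)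

theorem theorem4p4:
  fixes n t1 t2 :: nat
  assumes "1 \<le> t1" and "t1 < t2" and "t2 < n"
  shows "claw_free (with_proj (toeplitz_graph n t1 t2)) \<longleftrightarrow> n \<le> t1 + t2 \<or> t2 = 2 * t1"
proof -
  let ?G = "with_proj (toeplitz_graph n t1 t2)"
  interpret pair_graph "toeplitz_graph n t1 t2"
    using assms by (intro pair_graph_toeplitz_graph) auto
  have "graph ?G"
    by unfold_locales
  note claw_free_iff = graph.claw_free_iff[OF this, unfolded toeplitz_adjacent_iff]
  show ?thesis
  proof
    assume free: "claw_free ?G"
    show "n \<le> t1 + t2 \<or> t2 = 2 * t1"
    proof (rule ccontr)
      assume "\<not> (n \<le> t1 + t2 \<or> t2 = 2 * t1)"
      then have "\<not> claw_free ?G"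
        unfolding claw_free_iff not_not using assms
        by (intro exI[of _ "1 + t1"] exI[of _ 1] exI[of _ "1 + 2 * t1"] exI[of _ "1 + t1 + t2"])
          auto
      then show False
        using free by contradiction
    qed
  next
    assume few_or_double: "n \<le> t1 + t2 \<or> t2 = 2 * t1"
    let ?neighbour = "\<lambda>c x. x = c + t1 \<or> c = x + t1 \<or> x = c + t2 \<or> c = x + t2"
    have False
      if range: "c \<in> {1..n}" "x \<in> {1..n}" "y \<in> {1..n}" "z \<in> {1..n}"
        and distinct: "x \<noteq> y" "x \<noteq> z" "y \<noteq> z"
        and adjacent: "?neighbour c x" "?neighbour c y" "?neighbour c z"
        and independent: "\<not> ?neighbour x y" "\<not> ?neighbour x z" "\<not> ?neighbour y z"
      for c x y z
      using few_or_double
    proof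
      assume few: "n \<le> t1 + t2"
      \<comment> \<open>The neighbours of \<open>c\<close> always lie in a set of two values. Where a difference below truncates
        to \<open>0\<close>, it is not a vertex, so listing it among the two values does no harm.\<close>
      have no_three: False if "x \<in> {a, b}" "y \<in> {a, b}" "z \<in> {a, b}" for a b
        using that distinct by auto
      consider (above) "c + t2 \<le> n" | (below) "t2 < c" | (near) "n < c + t2" "c \<le> t2"
        by linarith
      then show False
      proof cases
        case above
        then have "u \<in> {c + t1, c + t2}" if "?neighbour c u" "u \<in> {1..n}" for u
          using that few assms(2) by auto
        then show False
          using no_three adjacent range by blast
      next
        case below
        then have "u \<in> {c - t1, c - t2}" if "?neighbour c u" "u \<in> {1..n}" for u
          using that few assms(2) by auto
        then show False
          using no_three adjacent range by blast
      next
        case near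
        then have "u \<in> {c - t1, c + t1}" if "?neighbour c u" "u \<in> {1..n}" for u
          using that by auto
        then show False
          using no_three adjacent range by blast
      qed
    next
      assume double: "t2 = 2 * t1"
      have same_side: "u = v \<or> ?neighbour u v"
        if "?neighbour c u" "?neighbour c v" "c < u \<longleftrightarrow> c < v" for u v
        using that double assms(1) by auto
      consider "c < x \<longleftrightarrow> c < y" | "c < x \<longleftrightarrow> c < z" | "c < y \<longleftrightarrow> c < z"
        by blast
      then show False
      proof cases
        case 1
        then show False
          using same_side[OF adjacent(1,2)] distinct(1) independent(1) by blast
      next
        case 2
        then show False
          using same_side[OF adjacent(1,3)] distinct(2) independent(2) by blast
      next
        case 3
        then show False
          using same_side[OF adjacent(2,3)] distinct(3) independent(3) by blast
      qed
    qed
    then show "claw_free ?G"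
      unfolding claw_free_iff by blast
  qed
qed

end
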